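(* Let $\omega$ be a finite permutation of length $l$ with natural word $\eta=\eta_1\cdots\eta_l$. For $1\le p\le l$, let $c_p$ be the tower index (first coordinate) of the cell created at the $p$-th step when sliding $\eta_1,\eta_2,\dots,\eta_l$ successively into $\varnothing$, and let $r_p$ be the tower index of the cell created at the $(l+1-p)$-th step when sliding the reversed word $\eta_l,\eta_{l-1},\dots,\eta_1$ successively into $\varnothing$. Then the Rothe diagram of $\omega$ is $$D_\omega=\{(r_p,c_p):1\le p\le l\}$$ (first coordinate = row, second = column).
   Context: $s_i=(i,i+1)$; permutations compose as functions ($\omega=s_{\alpha_1}\cdots s_{\alpha_\ell}$ means $\omega(x)=s_{\alpha_1}(\cdots s_{\alpha_\ell}(x))$); a reduced word of $\omega$ is such a word with $\ell=\ell(\omega)$ minimal. The Rothe diagram of $\omega\in S_n$ is $D_\omega=\{(i,j):1\le i,j\le n,\ j<\omega(i),\ i<\omega^{-1}(j)\}$ (row $i$, column $j$). A cell is a pair $(i,j)$ of integers with $i\ge 1$, $j\ge 0$. A tower diagram is a finite set $\mathcal T$ of cells such that $(i,j)\in\mathcal T$ and $0\le k\le j$ imply $(i,k)\in\mathcal T$; its $i$-th tower consists of its cells with first coordinate $i$. The cell $(i,j)$ lies on the diagonal $x+y=i+j$. Flight paths (recursive): a cell $(i,j)\in\mathcal T$ has a flight path in $\mathcal T$ if either (F1) there is no cell $(i',j')\in\mathcal T$ with $i'<i$ and $i'+j'=i+j-1$ (flight path $\{(i,j)\}$), or (F2) such cells exist and, letting $(i',j')$ be the one with largest $i'$, $(i',j')$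 has a flight path and $(i',j'+1)\in\mathcal T$ (flight path $\{(i,j),(i',j'+1)\}\cup\mathrm{flightpath}((i',j'),\mathcal T)$). The flight number of such a cell is $a+b$ for $(a,b)$ the lexicographically smallest element of its flight path. Sliding: for a positive integer $\alpha$, $\alpha^{\searrow}\mathcal T$ is computed by the procedure $P(\gamma,m)$ started at $\gamma=\alpha$, $m=1$: (S1) if no cell $(i,j)\in\mathcal T$ with $i\ge m$ lies on $x+y=\gamma-1$: (a) if $(\gamma,0)\notin\mathcal T$ the result is $\mathcal T\cup\{(\gamma,0)\}$; (b) if $(\gamma,0)\in\mathcal T$, $(\gamma,1)\notin\mathcal T$ the slide terminates (without result); (c) if $(\gamma,0),(\gamma,1)\in\mathcal T$, continue with $P(\gamma+1,\gamma+1)$. (S2) Otherwise let $i\ge m$ be smallest with $(i,\gamma-1-i)\in\mathcal T$: (a) if $(i,\gamma-i)\notin\mathcal T$ the result is $\mathcal T\cup\{(i,\gamma-i)\}$; (b) if $(i,\gamma-i)\in\mathcal T$, $(i,\gamma-i+1)\notin\mathcal T$ the slide terminates; (c) if both are in $\mathcal T$, continue with $P(\gamma+1,i+1)$. A non-terminating slide adds exactly one new cell (the cell "created"). The tower diagram $\mathcal T_\omega$ of $\omega$ is obtained from $\varnothing$ by successively sliding the letters of any reduced word of $\omega$ (no slide terminates; the result is independent of the choice). The natural labelling of $\mathcal T_\omega$ labels its cells $1,2,\dots$ starting with the rightmost nonempty tower from bottom to top, then the next nonempty tower to its left from bottom to top, and so on. The natural word $\eta$ of $\omega$ is the reading word of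 this labelling: its $k$-th letter is the flight number of the cell labelled $k$ in the diagram formed by the cells labelled $1,\dots,k$. Equivalently, if the nonempty towers of $\mathcal T_\omega$ are at positions $i_1>\dots>i_s$ with heights $h_1,\dots,h_s$, then $\eta=(i_1,\dots,i_1+h_1-1)\cdots(i_s,\dots,i_s+h_s-1)$; it is a reduced word of $\omega$, and its reversal $\eta_l\cdots\eta_1$ is a reduced word of $\omega^{-1}$. *)

theory Defs
  imports "HOL-Combinatorics.Permutations"
begin

text \<open>
  Finite permutations are functions \<open>\<omega> :: nat \<Rightarrow> nat\<close> that permute \<open>{1..n}\<close> and fix every
  other number, in particular \<open>0\<close>.
\<close>

definition word_perm :: "nat list \<Rightarrow> nat \<Rightarrow> nat" where
  "word_perm \<alpha>s = foldr (\<lambda>a f. transpose a (a + 1) \<circ> f) \<alpha>s id"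

definition is_word_of :: "(nat \<Rightarrow> nat) \<Rightarrow> nat list \<Rightarrow> bool" where
  "is_word_of \<omega> \<alpha>s \<longleftrightarrow> (\<forall>a \<in> set \<alpha>s. 1 \<le> a) \<and> word_perm \<alpha>s = \<omega>"

definition perm_length :: "(nat \<Rightarrow> nat) \<Rightarrow> nat" where
  "perm_length \<omega> = (LEAST k. \<exists>\<alpha>s. is_word_of \<omega> \<alpha>s \<and> length \<alpha>s = k)"

definition is_reduced_word_of :: "(nat \<Rightarrow> nat) \<Rightarrow> nat list \<Rightarrow> bool" where
  "is_reduced_word_of \<omega> \<alpha>s \<longleftrightarrow> is_word_of \<omega> \<alpha>s \<and> length \<alpha>s = perm_length \<omega>"

definition rothe_diagram :: "nat \<Rightarrow> (nat \<Rightarrow> nat) \<Rightarrow> (nat \<times> nat) set" where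
  "rothe_diagram n \<omega> =
     {(i, j). 1 \<le> i \<and> i \<le> n \<and> 1 \<le> j \<and> j \<le> n \<and> j < \<omega> i \<and> i < inv \<omega> j}"

text \<open>
  Cells lie in \<open>{1..} \<times> {0..}\<close>, so natural numbers suffice; diagonal equations are written
  additively (\<open>i + j + 1 = \<gamma>\<close> for \<open>i + j = \<gamma> - 1\<close>) because subtraction on \<open>nat\<close> truncates.
\<close>

type_synonym cell = "nat \<times> nat"

text \<open>
  \<open>slide_from T \<gamma> m\<close> is the procedure \<open>P(\<gamma>, m)\<close>; it returns the cell \<open>c\<close> that is created, so the
  resulting diagram is \<open>insert c T\<close>, and \<open>None\<close> if the slide terminates without result.
  The recursion stops for every finite \<open>T\<close>, since each recursive call requires a cell of \<open>T\<close> on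
  \<open>x + y = \<gamma>\<close>.  In the last three branches \<open>i < \<gamma>\<close>, so \<open>\<gamma> - i\<close> is not truncated.
\<close>

partial_function (option) slide_from :: "cell set \<Rightarrow> nat \<Rightarrow> nat \<Rightarrow> cell option" where
  "slide_from T \<gamma> m =
    (if \<not> (\<exists>i j. m \<le> i \<and> i + j + 1 = \<gamma> \<and> (i, j) \<in> T) then
       (if (\<gamma>, 0) \<notin> T then Some (\<gamma>, 0)
        else if (\<gamma>, 1) \<notin> T then None
        else slide_from T (\<gamma> + 1) (\<gamma> + 1))
     else
       (let i = (LEAST i. m \<le> i \<and> (\<exists>j. i + j + 1 = \<gamma> \<and> (i, j) \<in> T)) in
        if (i, \<gamma> - i) \<notin> T then Some (i, \<gamma> - i)
        else if (i, \<gamma> - i + 1) \<notin> T then None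
        else slide_from T (\<gamma> + 1) (i + 1)))"

definition slide :: "cell set \<Rightarrow> nat \<Rightarrow> cell option" where
  "slide T \<alpha> = slide_from T \<alpha> 1"

text \<open>
  The cells created, in order, when the letters of a word are slid successively into \<open>T\<close>;
  \<open>None\<close> if some slide terminates.
\<close>

fun created_cells :: "cell set \<Rightarrow> nat list \<Rightarrow> cell list option" where
  "created_cells T [] = Some []"
| "created_cells T (\<alpha> # \<alpha>s) =
     (case slide T \<alpha> of
        None \<Rightarrow> None
      | Some c \<Rightarrow> map_option ((#) c) (created_cells (insert c T) \<alpha>s))"

text \<open>Sliding a word into \<open>{}\<close> yields the diagram consisting of all the created cells.\<close>

definition tower_diagram :: "(nat \<Rightarrow> nat) \<Rightarrow> cell set" where
  "tower_diagram \<omega> =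
     (THE T. \<exists>\<alpha>s cs. is_reduced_word_of \<omega> \<alpha>s \<and> created_cells {} \<alpha>s = Some cs \<and> T = set cs)"

inductive flight_path :: "cell set \<Rightarrow> cell \<Rightarrow> cell set \<Rightarrow> bool" for T :: "cell set" where
  F1: "flight_path T (i, j) {(i, j)}"
    if "(i, j) \<in> T"
      and "\<not> (\<exists>i' j'. (i', j') \<in> T \<and> i' < i \<and> i' + j' + 1 = i + j)"
| F2: "flight_path T (i, j) ({(i, j), (i', j' + 1)} \<union> P)"
    if "(i, j) \<in> T"
      and "(i', j') \<in> T" and "i' < i" and "i' + j' + 1 = i + j"
      and "\<forall>i'' j''. (i'', j'') \<in> T \<and> i'' < i \<and> i'' + j'' + 1 = i + j \<longrightarrow> i'' \<le> i'"
      and "flight_path T (i', j') P"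
      and "(i', j' + 1) \<in> T"

definition flight_number :: "cell set \<Rightarrow> cell \<Rightarrow> nat" where
  "flight_number T c =
     (THE f. \<exists>P a b. flight_path T c P \<and> (a, b) \<in> P \<and>
        (\<forall>(a', b') \<in> P. a < a' \<or> (a = a' \<and> b \<le> b')) \<and> f = a + b)"

text \<open>
  The natural labelling as a list: position \<open>k\<close> (counted from \<open>0\<close>) holds the cell labelled
  \<open>k + 1\<close>.
\<close>

definition natural_labelling :: "cell set \<Rightarrow> cell list" where
  "natural_labelling T =
     [(i, j). i \<leftarrow> rev (sorted_list_of_set (fst ` T)), j \<leftarrow> sorted_list_of_set {j. (i, j) \<in> T}]"

definition reading_word :: "cell list \<Rightarrow> nat list" where
  "reading_word cs = map (\<lambda>k. flight_number (set (take (k + 1) cs)) (cs ! k)) [0..<length cs]"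

definition natural_word :: "(nat \<Rightarrow> nat) \<Rightarrow> nat list" where
  "natural_word \<omega> = reading_word (natural_labelling (tower_diagram \<omega>))"

end

theory Submission
  imports Defs
begin

text \<open>
  Let \<open>h\<^sub>j\<close> be the number of cells in column \<open>j\<close> of the Rothe diagram of \<open>\<omega>\<close>.  If
  \<open>\<omega> \<alpha> < \<omega> (\<alpha> + 1)\<close>, then the Rothe diagram of \<open>\<omega> s\<^sub>\<alpha>\<close> arises from that of \<open>\<omega>\<close> by
  exchanging the rows \<open>\<alpha>\<close> and \<open>\<alpha> + 1\<close> and adding the cell \<open>(\<alpha>, \<omega> \<alpha>)\<close>; and sliding \<open>\<alpha>\<close> into the
  diagram with tower heights \<open>h\<close> creates a cell in tower \<open>\<omega> \<alpha>\<close>, because during the slide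
  \<open>\<gamma> - m + 1\<close> is the rank of position \<open>\<alpha>\<close> once the values below \<open>m\<close> are deleted from \<open>\<omega>\<close>.
  Along a reduced word every letter is such an ascent, so
  \<open>c\<^sub>p = (s\<^bsub>\<eta>\<^sub>1\<^esub> \<dots> s\<^bsub>\<eta>\<^sub>p\<^sub>-\<^sub>1\<^esub>)(\<eta>\<^sub>p)\<close> and the Rothe diagram consists of the cells \<open>(r\<^sub>p, c\<^sub>p)\<close> for every
  reduced word.  The natural word is reduced, since its permutation has column heights \<open>h\<close> and
  \<open>h\<close> determines \<open>\<omega>\<close>.
\<close>

section \<open>Rothe diagrams, their column heights, and the effect of appending one letter\<close>

definition rothe :: "(nat \<Rightarrow> nat) \<Rightarrow> (nat \<times> nat) set" where
  "rothe \<omega> = {(i, j). j < \<omega> i \<and> i < inv \<omega> j}"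

text \<open>This is the Lehmer code of \<open>inv \<omega>\<close>: with
  \<open>k = \<omega> i\<close> it counts the \<open>k > j\<close> such that
  \<open>inv \<omega> k < inv \<omega> j\<close>.\<close>

definition code :: "(nat \<Rightarrow> nat) \<Rightarrow> nat \<Rightarrow> nat" where
  "code \<omega> j = card {i. (i, j) \<in> rothe \<omega>}"

definition tower :: "(nat \<Rightarrow> nat) \<Rightarrow> cell set" where
  "tower h = {(i, k). k < h i}"

text \<open>Without the bounds the diagram no longer refers to \<open>n\<close> and makes sense for
  every \<open>word_perm w\<close>. A column \<open>j\<close> outside \<open>{1..n}\<close> would be
  fixed and force \<open>i < j < \<omega> i\<close>, which fails for \<open>j = 0\<close> and for
  \<open>j > n\<close>.\<close>

lemma rothe_diagram_eq_rothe:
  assumes "\<omega> permutes {1..n}"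
  shows "rothe_diagram n \<omega> = rothe \<omega>"
proof -
  have fixed: "\<omega> x = x" "inv \<omega> x = x" if "x \<notin> {1..n}" for x
    using assms that permutes_inv[OF assms] by (auto simp: permutes_def)
  have bounds: "inv \<omega> x \<in> {1..n}" "\<omega> x \<in> {1..n}" if "x \<in> {1..n}" for x
    using permutes_in_image[OF assms] permutes_in_image[OF permutes_inv[OF assms]] that by auto
  have "i \<in> {1..n} \<and> j \<in> {1..n}" if "j < \<omega> i" "i < inv \<omega> j" for i j
  proof -
    have j: "j \<in> {1..n}"
    proof (rule ccontr)
      assume "j \<notin> {1..n}"
      then have "i < j" "j < \<omega> i"
        using fixed(2)[of j] that by auto
      then show False
        using \<open>j \<notin> {1..n}\<close> fixed(1)[of i] bounds(2)[of i] by (cases "i \<in> {1..n}") auto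
    qed
    have "i \<noteq> 0"
      using fixed(1)[of 0] that(1) by (metis atLeastAtMost_iff less_nat_zero_code not_one_le_zero)
    then show ?thesis
      using j bounds(1)[OF j] that by auto
  qed
  then show ?thesis
    unfolding rothe_diagram_def rothe_def by fastforce
qed

lemma rothe_inv:
  assumes "bij \<omega>"
  shows "rothe (inv \<omega>) = prod.swap ` rothe \<omega>"
  unfolding rothe_def inv_inv_eq[OF assms] by force

lemma code_image:
  assumes "bij \<omega>"
  shows "code \<omega> (\<omega> x) = card {i. i < x \<and> \<omega> x < \<omega> i}"
  using assms unfolding code_def rothe_def by (simp add: bij_is_inj inv_f_f conj_commute)

lemma inv_comp_transpose:
  assumes "bij \<omega>"
  shows "inv (\<omega> \<circ> transpose a b) j = transpose a b (inv \<omega> j)"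
  using assms by (simp add: o_inv_distrib inv_transpose_eq)

lemma rothe_comp_transpose:
  assumes bij: "bij \<omega>" and asc: "\<omega> \<alpha> < \<omega> (\<alpha> + 1)"
  shows "rothe (\<omega> \<circ> transpose \<alpha> (\<alpha> + 1))
    = insert (\<alpha>, \<omega> \<alpha>) ((\<lambda>(i, j). (transpose \<alpha> (\<alpha> + 1) i, j)) ` rothe \<omega>)"
proof -
  let ?s = "transpose \<alpha> (\<alpha> + 1)"
  \<comment> \<open>Columns are named by positions: \<open>(i, \<omega> y)\<close> is a cell iff
    \<open>i < y\<close> and \<open>\<omega> y < \<omega> i\<close>. Swapping adjacent positions
    alters the order only of the pair \<alpha>, \<alpha> + 1, and \<open>asc\<close> makes this pair
    a new inversion.\<close>
  have key: "(?s i, \<omega> y) \<in> rothe (\<omega> \<circ> ?s) \<longleftrightarrow> (i, \<omega> y) \<in> rothe \<omega> \<or> (i = \<alpha> + 1 \<and> y = \<alpha>)" for i y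
  proof -
    have "(?s i, \<omega> y) \<in> rothe (\<omega> \<circ> ?s) \<longleftrightarrow> \<omega> y < \<omega> i \<and> ?s i < ?s y"
      using bij by (simp add: rothe_def inv_comp_transpose bij_is_inj)
    moreover have "?s i < ?s y \<longleftrightarrow> i < y" if "\<not> (i = \<alpha> + 1 \<and> y = \<alpha>)" "\<not> (i = \<alpha> \<and> y = \<alpha> + 1)"
      using that by (auto simp: transpose_def)
    moreover have "(i, \<omega> y) \<in> rothe \<omega> \<longleftrightarrow> \<omega> y < \<omega> i \<and> i < y"
      using bij by (simp add: rothe_def bij_is_inj)
    ultimately show ?thesis
      using asc by (cases "i = \<alpha> + 1 \<and> y = \<alpha>"; cases "i = \<alpha> \<and> y = \<alpha> + 1") auto
  qed
  show ?thesis
  proof (intro set_eqI, clarify)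
    fix i j
    obtain y where j: "j = \<omega> y"
      using bij by (metis bij_pointE)
    have "(i, j) \<in> rothe (\<omega> \<circ> ?s) \<longleftrightarrow> (?s i, j) \<in> rothe \<omega> \<or> (?s i = \<alpha> + 1 \<and> y = \<alpha>)"
      using key[of "?s i" y] j by simp
    moreover have "?s i = \<alpha> + 1 \<longleftrightarrow> i = \<alpha>"
      by (auto simp: transpose_def)
    moreover have "y = \<alpha> \<longleftrightarrow> j = \<omega> \<alpha>"
      using bij j by (simp add: bij_is_inj inj_eq)
    moreover have "(?s i, j) \<in> rothe \<omega>
        \<longleftrightarrow> (i, j) \<in> (\<lambda>(i, j). (?s i, j)) ` rothe \<omega>"
      by (force simp: image_iff)
    ultimately show "(i, j) \<in> rothe (\<omega> \<circ> ?s)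
        \<longleftrightarrow> (i, j) \<in> insert (\<alpha>, \<omega> \<alpha>) ((\<lambda>(i, j). (?s i, j)) ` rothe \<omega>)"
      by auto
  qed
qed

lemma new_cell_notin_image:
  assumes "bij \<omega>"
  shows "(\<alpha>, \<omega> \<alpha>) \<notin> (\<lambda>(i, j). (transpose \<alpha> (\<alpha> + 1) i, j)) ` rothe \<omega>"
proof
  assume "(\<alpha>, \<omega> \<alpha>) \<in> (\<lambda>(i, j). (transpose \<alpha> (\<alpha> + 1) i, j)) ` rothe \<omega>"
  then obtain i where "transpose \<alpha> (\<alpha> + 1) i = \<alpha>" and i: "(i, \<omega> \<alpha>) \<in> rothe \<omega>"
    by clarsimp metis
  then have "i = \<alpha> + 1"
    by (metis transpose_apply_first transpose_involutory)
  then show False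
    using i assms by (simp add: rothe_def bij_is_inj)
qed

lemma inj_transpose_row: "inj_on (\<lambda>(i, j). (transpose a b i, j)) A"
  by (auto simp: inj_on_def dest: injD[OF inj_transpose])

lemma card_rothe_comp_transpose:
  assumes "bij \<omega>" and "\<omega> \<alpha> < \<omega> (\<alpha> + 1)"
  shows "finite (rothe (\<omega> \<circ> transpose \<alpha> (\<alpha> + 1))) \<longleftrightarrow> finite (rothe \<omega>)"
    and "finite (rothe \<omega>) \<Longrightarrow>
      card (rothe (\<omega> \<circ> transpose \<alpha> (\<alpha> + 1))) = card (rothe \<omega>) + 1"
  unfolding rothe_comp_transpose[OF assms]
  using new_cell_notin_image[OF assms(1), of \<alpha>]
  by (simp_all add: finite_image_iff[OF inj_transpose_row] card_image[OF inj_transpose_row])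

lemma code_comp_transpose:
  assumes "bij \<omega>" and "\<omega> \<alpha> < \<omega> (\<alpha> + 1)"
  shows "code (\<omega> \<circ> transpose \<alpha> (\<alpha> + 1)) = (code \<omega>)(\<omega> \<alpha> := code \<omega> (\<omega> \<alpha>) + 1)"
proof
  fix j
  let ?s = "transpose \<alpha> (\<alpha> + 1)"
  have fin: "finite {i. (i, j) \<in> rothe \<omega>}"
    by (rule finite_subset[of _ "{..<inv \<omega> j}"]) (auto simp: rothe_def)
  have "{i. (i, j) \<in> rothe (\<omega> \<circ> ?s)}
      = (if j = \<omega> \<alpha> then {\<alpha>} else {}) \<union> ?s ` {i. (i, j) \<in> rothe \<omega>}"
    unfolding rothe_comp_transpose[OF assms] by auto
  moreover have "j = \<omega> \<alpha> \<Longrightarrow> \<alpha> \<notin> ?s ` {i. (i, j) \<in> rothe \<omega>}"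
    using new_cell_notin_image[OF assms(1), of \<alpha>] by force
  moreover have "card (?s ` {i. (i, j) \<in> rothe \<omega>}) = code \<omega> j"
    unfolding code_def by (intro card_image inj_on_subset[OF inj_transpose] subset_UNIV)
  ultimately show "code (\<omega> \<circ> ?s) j = ((code \<omega>)(\<omega> \<alpha> := code \<omega> (\<omega> \<alpha>) + 1)) j"
    using fin unfolding code_def[of "\<omega> \<circ> ?s"] by auto
qed

lemma tower_fun_upd_Suc: "tower (h(j := h j + 1)) = insert (j, h j) (tower h)"
  by (auto simp: tower_def split: if_splits)

text \<open>Strong induction on values. If the inverses agree below \<open>j\<close> and
  \<open>inv u j < inv v j\<close>, then column \<open>j\<close> of \<open>rothe u\<close> is
  contained in that of \<open>rothe v\<close>, which has \<open>inv u j\<close> as an additional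
  row; so the heights differ.\<close>

lemma code_inj:
  assumes "bij \<omega>" "bij \<omega>'" "code \<omega> = code \<omega>'"
  shows "\<omega> = \<omega>'"
proof -
  have not_less: "\<not> inv u j < inv v j"
    if bij: "bij u" "bij v" and code: "code u = code v" and IH: "\<And>k. k < j \<Longrightarrow> inv u k = inv v k"
    for u v :: "nat \<Rightarrow> nat" and j
  proof
    assume less: "inv u j < inv v j"
    have u: "u (inv u k) = k" "inv u (u x) = x" and v: "v (inv v k) = k" "inv v (v x) = x" for k x
      using bij by (simp_all add: bij_is_surj surj_f_inv_f bij_is_inj)
    have "u i < j \<longleftrightarrow> v i < j" for i
      using IH u v by metis
    then have sub: "(i, j) \<in> rothe v" if "(i, j) \<in> rothe u" for i
      using that less v(2)[of i] unfolding rothe_def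
      by clarsimp (metis less_trans linorder_neqE_nat order_less_asym)
    have "v (inv u j) \<noteq> j" "\<not> v (inv u j) < j"
      using less u v \<open>\<And>i. u i < j \<longleftrightarrow> v i < j\<close>[of "inv u j"] by auto (metis less_irrefl)
    then have "(inv u j, j) \<in> rothe v"
      using less by (simp add: rothe_def)
    moreover have "(inv u j, j) \<notin> rothe u"
      by (simp add: rothe_def)
    ultimately have "{i. (i, j) \<in> rothe u} \<subset> {i. (i, j) \<in> rothe v}"
      using sub by blast
    moreover have "finite {i. (i, j) \<in> rothe v}"
      by (rule finite_subset[of _ "{..<inv v j}"]) (auto simp: rothe_def)
    ultimately have "code u j < code v j"
      unfolding code_def by (rule psubset_card_mono[rotated])
    then show False
      using code by simp
  qed
  have "inv \<omega> j = inv \<omega>' j" for j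
  proof (induction j rule: less_induct)
    case (less j)
    then show ?case
      using not_less[of \<omega> \<omega>' j] not_less[of \<omega>' \<omega> j] assms by (metis linorder_neqE_nat)
  qed
  then show ?thesis
    using assms by (metis ext inv_inv_eq)
qed

section \<open>Sliding at an ascent\<close>

text \<open>The \<open>LEAST\<close> search becomes a scan that inspects only tower
  \<open>m\<close>, so a slide can be followed by induction on \<open>m\<close>. Rule S1 is absorbed
  by the case \<open>m = \<gamma>\<close>, where \<open>(m, \<gamma> - m)\<close> is the ground cell
  \<open>(\<gamma>, 0)\<close>.\<close>

lemma slide_from_step:
  assumes "m \<le> \<gamma>"
  shows "slide_from T \<gamma> m =
    (if m < \<gamma> \<and> (m, \<gamma> - 1 - m) \<notin> T then slide_from T \<gamma> (m + 1)
     else if (m, \<gamma> - m) \<notin> T then Some (m, \<gamma> - m)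
     else if (m, \<gamma> - m + 1) \<notin> T then None
     else slide_from T (\<gamma> + 1) (m + 1))"
proof -
  let ?Q = "\<lambda>m i. m \<le> i \<and> (\<exists>j. i + j + 1 = \<gamma> \<and> (i, j) \<in> T)"
  consider "m = \<gamma>" | "m < \<gamma>" "(m, \<gamma> - 1 - m) \<notin> T" | "m < \<gamma>" "(m, \<gamma> - 1 - m) \<in> T"
    using assms by linarith
  then show ?thesis
  proof cases
    case 1
    then show ?thesis
      by (subst slide_from.simps) auto
  next
    case 2
    then have "\<not> ?Q m m"
      by auto
    then have "?Q m = ?Q (m + 1)"
      by (intro ext) (metis Suc_eq_plus1 Suc_leD le_antisym not_less_eq_eq)
    moreover from this
    have "(\<exists>i j. m \<le> i \<and> i + j + 1 = \<gamma> \<and> (i, j) \<in> T)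
        \<longleftrightarrow> (\<exists>i j. m + 1 \<le> i \<and> i + j + 1 = \<gamma> \<and> (i, j) \<in> T)"
      by (metis (no_types, lifting))
    ultimately have "slide_from T \<gamma> m = slide_from T \<gamma> (m + 1)"
      by (subst (1 2) slide_from.simps) (simp only: )
    with 2 show ?thesis
      by simp
  next
    case 3
    then have "?Q m m"
      by (auto intro!: exI[of _ "\<gamma> - 1 - m"])
    then have "Least (?Q m) = m" and "\<exists>i j. m \<le> i \<and> i + j + 1 = \<gamma> \<and> (i, j) \<in> T"
      by (auto intro!: Least_equality)
    with 3 show ?thesis
      by (subst slide_from.simps) (simp add: Let_def)
  qed
qed

lemma slide_tower_code:
  assumes bij: "bij \<omega>" and zero: "\<omega> 0 = 0" and asc: "\<omega> \<alpha> < \<omega> (\<alpha> + 1)" and "1 \<le> \<alpha>"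
  shows "slide (tower (code \<omega>)) \<alpha> = Some (\<omega> \<alpha>, code \<omega> (\<omega> \<alpha>))"
proof -
  \<comment> \<open>if \<open>m \<le> \<omega> x\<close>, this is \<open>m - 1\<close> plus the rank of \<open>x\<close> among the positions of the values \<open>\<ge> m\<close>\<close>
  define rank where "rank m x = m + card {y. y < x \<and> m \<le> \<omega> y}" for m x
  have rank_self: "rank (\<omega> y) y = \<omega> y + code \<omega> (\<omega> y)" for y
  proof -
    have "{x. x < y \<and> \<omega> y \<le> \<omega> x} = {x. x < y \<and> \<omega> y < \<omega> x}"
      using bij by (auto simp: le_less bij_is_inj inj_eq)
    then show ?thesis
      by (simp add: rank_def code_image[OF bij])
  qed
  have mono: "rank m x \<le> rank m y" if "x \<le> y" for m x y
    using that unfolding rank_def by (auto intro!: card_mono)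
  have strict: "rank m x < rank m y" if "x < y" "m \<le> \<omega> x" for m x y
    using that unfolding rank_def by (auto intro!: psubset_card_mono)
  have rank_Suc: "rank (Suc (\<omega> y)) x = (if y < x then rank (\<omega> y) x else Suc (rank (\<omega> y) x))" for x y
  proof (cases "y < x")
    case True
    have "{z. z < x \<and> \<omega> y \<le> \<omega> z} = insert y {z. z < x \<and> Suc (\<omega> y) \<le> \<omega> z}"
      using True bij by (auto simp: le_less Suc_le_eq bij_is_inj inj_eq)
    then show ?thesis
      using True by (simp add: rank_def)
  next
    case False
    have "{z. z < x \<and> \<omega> y \<le> \<omega> z} = {z. z < x \<and> Suc (\<omega> y) \<le> \<omega> z}"
      using False bij by (auto simp: le_less Suc_le_eq bij_is_inj inj_eq)
    then show ?thesis
      using False by (simp add: rank_def)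
  qed
  \<comment> \<open>Invariant of the scan: when it reaches tower \<open>m\<close>, the current
    \<open>\<gamma>\<close> is \<open>rank m \<alpha>\<close>. The induction descends from
    \<open>m = \<omega> \<alpha>\<close>.\<close>
  have "slide_from (tower (code \<omega>)) (rank m \<alpha>) m = Some (\<omega> \<alpha>, code \<omega> (\<omega> \<alpha>))" if "m \<le> \<omega> \<alpha>" for m
    using that
  proof (induction m rule: inc_induct)
    \<comment> \<open>By \<open>rank_self\<close>, \<open>\<gamma> - m\<close> is the height of
      tower \<open>\<omega> \<alpha>\<close>, so the scan stops at its first free cell.\<close>
    case base
    have "\<omega> \<alpha> \<le> rank (\<omega> \<alpha>) \<alpha>"
      by (simp add: rank_def)
    then show ?case
      by (subst slide_from_step) (auto simp: tower_def rank_self)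
  next
    case (step m)
    obtain y where y: "m = \<omega> y"
      using bij by (metis bij_pointE)
    have le: "m \<le> rank m \<alpha>"
      by (simp add: rank_def)
    \<comment> \<open>The value \<open>m\<close> is below \<open>\<omega> \<alpha>\<close> and hence
      below \<open>\<omega> (\<alpha> + 1)\<close>. If it stands before \<alpha>, its tower is too
      low to be hit; if it stands after \<alpha> + 1, its tower is high enough to be
      crossed.\<close>
    have "y \<noteq> \<alpha>" "y \<noteq> \<alpha> + 1"
      using step.hyps asc y by auto
    then consider "y < \<alpha>" | "\<alpha> + 1 < y"
      by linarith
    then show ?case
    proof cases
      case 1
      then have "m + code \<omega> m < rank m \<alpha>"
        using strict[of y \<alpha> m] y by (simp add: rank_self)
      then have "m < rank m \<alpha>" "(m, rank m \<alpha> - 1 - m) \<notin> tower (code \<omega>)"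
        by (auto simp: tower_def)
      moreover have "rank (Suc m) \<alpha> = rank m \<alpha>"
        using 1 y by (simp add: rank_Suc)
      ultimately show ?thesis
        using step.IH le by (subst slide_from_step) auto
    next
      case 2
      \<comment> \<open>The positions \<alpha>, \<alpha> + 1 and \<open>y\<close> give two strict
        increases of the rank. This gap of two puts both cells required for a crossing into the
        tower and so rules out termination.\<close>
      have "rank m \<alpha> < rank m (\<alpha> + 1)" "rank m (\<alpha> + 1) < rank m y"
        using strict[of \<alpha> "\<alpha> + 1" m] strict[of "\<alpha> + 1" y m] 2 step.hyps asc by auto
      then have "rank m \<alpha> + 1 < m + code \<omega> m"
        using y by (simp add: rank_self)
      then have "(m, rank m \<alpha> - 1 - m) \<in> tower (code \<omega>)" "(m, rank m \<alpha> - m) \<in> tower (code \<omega>)"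
        "(m, rank m \<alpha> - m + 1) \<in> tower (code \<omega>)"
        using le by (auto simp: tower_def)
      moreover have "rank (Suc m) \<alpha> = rank m \<alpha> + 1"
        using 2 y by (simp add: rank_Suc)
      ultimately show ?thesis
        using step.IH le by (subst slide_from_step) auto
    qed
  qed
  moreover have "1 \<le> \<omega> \<alpha>"
    using bij zero \<open>1 \<le> \<alpha>\<close> by (metis bij_is_inj inj_eq less_one not_less)
  \<comment> \<open>Only position 0 carries a value below 1, so the invariant holds at the start of
    the slide.\<close>
  moreover have "rank 1 \<alpha> = \<alpha>"
  proof -
    have "{y. y < \<alpha> \<and> 1 \<le> \<omega> y} = {1..<\<alpha>}"
      using bij zero by (auto simp: Suc_le_eq) (metis bij_is_inj inj_eq neq0_conv)+
    then show ?thesis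
      using \<open>1 \<le> \<alpha>\<close> by (simp add: rank_def)
  qed
  ultimately show ?thesis
    unfolding slide_def by metis
qed

section \<open>Reduced words\<close>

lemma word_perm_append: "word_perm (v @ w) = word_perm v \<circ> word_perm w"
  by (induction v) (simp_all add: word_perm_def comp_assoc)

lemma word_perm_Nil [simp]: "word_perm [] = (\<lambda>x. x)"
  by (simp add: word_perm_def id_def)

lemma word_perm_Cons: "word_perm (a # w) = transpose a (a + 1) \<circ> word_perm w"
  by (simp add: word_perm_def)

lemma word_perm_snoc: "word_perm (w @ [a]) = word_perm w \<circ> transpose a (a + 1)"
  by (simp add: fun_eq_iff word_perm_append word_perm_Cons)

lemma bij_word_perm: "bij (word_perm w)"
proof (induction w)
  case Nil
  show ?case
    using bij_id by (simp add: id_def)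
next
  case (Cons a w)
  then show ?case
    unfolding word_perm_Cons by (intro bij_comp) simp_all
qed

lemma word_perm_zero: "\<forall>a \<in> set w. 1 \<le> a \<Longrightarrow> word_perm w 0 = 0"
  by (induction w) (auto simp: word_perm_Cons transpose_def)

lemma word_perm_rev: "word_perm (rev w) = inv (word_perm w)"
proof (induction w)
  case (Cons a w)
  have "inv (word_perm (a # w)) = inv (word_perm w) \<circ> transpose a (a + 1)"
    unfolding word_perm_Cons by (simp add: o_inv_distrib bij_word_perm inv_transpose_eq)
  moreover have "word_perm (rev (a # w)) = word_perm (rev w) \<circ> transpose a (a + 1)"
    by (simp add: word_perm_snoc)
  ultimately show ?case
    using Cons by metis
qed (simp add: inv_id[unfolded id_def])

lemma rothe_ident: "rothe (\<lambda>x. x) = {}"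
  using inv_id by (auto simp: rothe_def id_def)

lemma code_ident: "code (\<lambda>x. x) = (\<lambda>_. 0)"
  by (rule ext) (simp add: code_def rothe_ident)

lemma card_rothe_snoc:
  fixes w :: "nat list" and a :: nat
  defines "u \<equiv> word_perm w"
  assumes fin: "finite (rothe u)"
  shows "finite (rothe (word_perm (w @ [a])))"
    and "u a < u (a + 1) \<Longrightarrow> card (rothe (word_perm (w @ [a]))) = card (rothe u) + 1"
    and "\<not> u a < u (a + 1) \<Longrightarrow> card (rothe (word_perm (w @ [a]))) + 1 = card (rothe u)"
proof -
  let ?s = "transpose a (a + 1)"
  have bij: "bij u" "bij (u \<circ> ?s)"
    unfolding u_def by (simp_all add: bij_word_perm bij_comp)
  have eq: "word_perm (w @ [a]) = u \<circ> ?s"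
    by (simp add: u_def word_perm_snoc)
  have asc: "finite (rothe (u \<circ> ?s)) \<and> card (rothe (u \<circ> ?s)) = card (rothe u) + 1"
    if "u a < u (a + 1)"
    using card_rothe_comp_transpose[OF bij(1) that] fin by blast
  \<comment> \<open>A descent is read backwards: \<open>u\<close> arises from
    \<open>u \<circ> ?s\<close> by an ascent.\<close>
  have desc: "finite (rothe (u \<circ> ?s)) \<and> card (rothe u) = card (rothe (u \<circ> ?s)) + 1"
    if "\<not> u a < u (a + 1)"
  proof -
    have "u a \<noteq> u (a + 1)"
      using bij(1) by (simp add: bij_is_inj inj_eq)
    then have "(u \<circ> ?s) a < (u \<circ> ?s) (a + 1)"
      using that by simp
    moreover have "u \<circ> ?s \<circ> ?s = u"
      by (simp add: comp_assoc)
    ultimately show ?thesis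
      using card_rothe_comp_transpose[OF bij(2)] fin by metis
  qed
  show "finite (rothe (word_perm (w @ [a])))"
    unfolding eq using asc desc by blast
  show "u a < u (a + 1) \<Longrightarrow> card (rothe (word_perm (w @ [a]))) = card (rothe u) + 1"
    unfolding eq using asc by blast
  show "\<not> u a < u (a + 1) \<Longrightarrow> card (rothe (word_perm (w @ [a]))) + 1 = card (rothe u)"
    unfolding eq using desc by simp
qed

text \<open>Each letter adds at most one cell. Equality serves as the criterion for a reduced word
  until \<open>perm_length\<close> is computed.\<close>

lemma card_rothe_word_perm_le:
  "finite (rothe (word_perm w)) \<and> card (rothe (word_perm w)) \<le> length w"
proof (induction w rule: rev_induct)
  case (snoc a w)
  then have fin: "finite (rothe (word_perm w))" and le: "card (rothe (word_perm w)) \<le> length w"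
    by auto
  show ?case
    using card_rothe_snoc[OF fin, of a] le
    by (cases "word_perm w a < word_perm w (a + 1)") auto
qed (simp add: rothe_ident)

lemma created_cells_snoc:
  "created_cells T (w @ [a]) =
    (case created_cells T w of None \<Rightarrow> None
     | Some cs \<Rightarrow> map_option (\<lambda>c. cs @ [c]) (slide (T \<union> set cs) a))"
proof (induction w arbitrary: T)
  case Nil
  then show ?case
    by (simp split: option.split)
next
  case (Cons b w)
  then show ?case
    by (auto simp: option.map_comp comp_def split: option.split)
qed

text \<open>A descent would remove a cell, while the shorter word supplies at most
  \<open>length w\<close> of them.\<close>

lemma reduced_snocD:
  assumes "card (rothe (word_perm (w @ [a]))) = length (w @ [a])"
  shows "word_perm w a < word_perm w (a + 1)" and "card (rothe (word_perm w)) = length w"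
proof -
  have fin: "finite (rothe (word_perm w))" and le: "card (rothe (word_perm w)) \<le> length w"
    using card_rothe_word_perm_le by auto
  show "word_perm w a < word_perm w (a + 1)"
  proof (rule ccontr)
    assume "\<not> ?thesis"
    then show False
      using card_rothe_snoc(3)[OF fin, of a] le assms by simp
  qed
  then show "card (rothe (word_perm w)) = length w"
    using card_rothe_snoc(2)[OF fin, of a] assms by simp
qed

text \<open>Every letter is an ascent, so the cell given by \<open>slide_tower_code\<close> is
  exactly the one by which \<open>code_comp_transpose\<close> enlarges the diagram.\<close>

lemma created_cells_reduced:
  assumes "card (rothe (word_perm w)) = length w" and "\<forall>a \<in> set w. 1 \<le> a"
  shows "\<exists>cs. created_cells {} w = Some cs \<and> set cs = tower (code (word_perm w)) \<and>
    map fst cs = map (\<lambda>p. word_perm (take p w) (w ! p)) [0..<length w]"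
  using assms
proof (induction w rule: rev_induct)
  case Nil
  then show ?case
    by (simp add: code_ident tower_def)
next
  case (snoc a w)
  let ?u = "word_perm w"
  have asc: "?u a < ?u (a + 1)" and red: "card (rothe ?u) = length w"
    using reduced_snocD[OF snoc.prems(1)] by auto
  have pos: "\<forall>a \<in> set w. 1 \<le> a" "1 \<le> a"
    using snoc.prems(2) by auto
  obtain cs where cs: "created_cells {} w = Some cs" "set cs = tower (code ?u)"
    "map fst cs = map (\<lambda>p. word_perm (take p w) (w ! p)) [0..<length w]"
    using snoc.IH[OF red pos(1)] by blast
  have "slide (tower (code ?u)) a = Some (?u a, code ?u (?u a))"
    using slide_tower_code[OF bij_word_perm word_perm_zero[OF pos(1)] asc pos(2)] .
  then have "created_cells {} (w @ [a]) = Some (cs @ [(?u a, code ?u (?u a))])"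
    by (simp add: created_cells_snoc cs)
  moreover have "set (cs @ [(?u a, code ?u (?u a))]) = tower (code (word_perm (w @ [a])))"
    unfolding word_perm_snoc code_comp_transpose[OF bij_word_perm asc] tower_fun_upd_Suc
    by (simp add: cs)
  moreover have "map fst (cs @ [(?u a, code ?u (?u a))])
      = map (\<lambda>p. word_perm (take p (w @ [a])) ((w @ [a]) ! p)) [0..<length (w @ [a])]"
    by (auto simp: cs nth_append)
  ultimately show ?case
    by blast
qed

text \<open>Each letter contributes one cell, and later letters permute rows only. The row is thus
  \<open>w ! p\<close> moved by the later letters in turn, which is the tower index that
  \<open>created_cells_reduced\<close> gives for this letter in \<open>rev w\<close>.\<close>

lemma rothe_word_perm_reduced:
  assumes "card (rothe (word_perm w)) = length w"
  shows "rothe (word_perm w) =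
    (\<lambda>p. (word_perm (rev (drop (Suc p) w)) (w ! p), word_perm (take p w) (w ! p))) ` {..<length w}"
  using assms
proof (induction w rule: rev_induct)
  case Nil
  then show ?case
    by (simp add: rothe_ident)
next
  case (snoc a w)
  let ?s = "transpose a (a + 1)"
  have asc: "word_perm w a < word_perm w (a + 1)" and red: "card (rothe (word_perm w)) = length w"
    using reduced_snocD[OF snoc.prems] by auto
  have "rothe (word_perm (w @ [a]))
      = insert (a, word_perm w a) ((\<lambda>(i, j). (?s i, j)) ` rothe (word_perm w))"
    unfolding word_perm_snoc by (rule rothe_comp_transpose[OF bij_word_perm asc])
  also have "\<dots> = (\<lambda>p. (word_perm (rev (drop (Suc p) (w @ [a]))) ((w @ [a]) ! p),
      word_perm (take p (w @ [a])) ((w @ [a]) ! p))) ` {..<length (w @ [a])}"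
    unfolding snoc.IH[OF red] image_image
    by (auto simp: lessThan_Suc nth_append word_perm_Cons intro!: image_cong)
  finally show ?case .
qed

section \<open>The natural word\<close>

definition tower_word :: "(nat \<Rightarrow> nat) \<Rightarrow> nat list \<Rightarrow> nat list" where
  "tower_word h xs = concat (map (\<lambda>i. [i..<i + h i]) xs)"

text \<open>Towers are appended from right to left. The block of tower \<open>i\<close> carries the
  value \<open>i\<close> from position \<open>i\<close> rightwards past larger values, so each of
  its letters is an ascent that raises the code at \<open>i\<close> alone. The fixed points are what
  the next block starts from.\<close>

lemma word_perm_tower_word:
  assumes "sorted_wrt (>) xs" and "\<forall>x \<in> set xs. 1 \<le> x"
  shows "\<forall>a \<in> set (tower_word h xs). 1 \<le> a"
    and "\<And>y. \<forall>x \<in> set xs. y < x \<Longrightarrow> word_perm (tower_word h xs) y = y"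
    and "code (word_perm (tower_word h xs)) = (\<lambda>j. if j \<in> set xs then h j else 0)"
    and "card (rothe (word_perm (tower_word h xs))) = length (tower_word h xs)"
proof -
  show "\<forall>a \<in> set (tower_word h xs). 1 \<le> a"
    using assms(2) by (force simp: tower_word_def)
  have "(\<forall>y. (\<forall>x \<in> set xs. y < x) \<longrightarrow> word_perm (tower_word h xs) y = y) \<and>
    code (word_perm (tower_word h xs)) = (\<lambda>j. if j \<in> set xs then h j else 0) \<and>
    card (rothe (word_perm (tower_word h xs))) = length (tower_word h xs)"
    using assms
  proof (induction xs rule: rev_induct)
    case Nil
    then show ?case
      by (simp add: tower_word_def code_ident rothe_ident)
  next
    case (snoc i xs)
    let ?w = "tower_word h xs"
    let ?c = "\<lambda>j. if j \<in> set xs then h j else 0"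
    have below: "\<forall>x \<in> set xs. i < x"
      using snoc.prems by (simp add: sorted_wrt_append)
    have IH: "\<And>y. \<forall>x \<in> set xs. y < x \<Longrightarrow> word_perm ?w y = y"
      "code (word_perm ?w) = ?c" "card (rothe (word_perm ?w)) = length ?w"
      using snoc by (auto simp: sorted_wrt_append)
    have fixed: "word_perm ?w y = y" if "y \<le> i" for y
      using that below by (intro IH(1)) (auto intro: le_less_trans)
    have "(\<forall>y < i. word_perm (?w @ [i..<i + k]) y = y) \<and> word_perm (?w @ [i..<i + k]) (i + k) = i \<and>
      code (word_perm (?w @ [i..<i + k])) = ?c(i := k) \<and>
      card (rothe (word_perm (?w @ [i..<i + k]))) = length ?w + k" for k
    proof (induction k)
      case 0
      have "i \<notin> set xs"
        using below by auto
      then show ?case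
        using IH(2,3) fixed by auto
    next
      case (Suc k)
      let ?v = "?w @ [i..<i + k]"
      let ?u = "word_perm ?v"
      have u: "\<And>y. y < i \<Longrightarrow> ?u y = y" "?u (i + k) = i" "code ?u = ?c(i := k)"
        "card (rothe ?u) = length ?w + k"
        using Suc by auto
      have w: "?w @ [i..<i + Suc k] = ?v @ [i + k]"
        by simp
      have inj: "inj ?u"
        by (simp add: bij_word_perm bij_is_inj)
      \<comment> \<open>Values below \<open>i\<close> stay at their own positions and
        \<open>i\<close> is taken by position \<open>i + k\<close>, so injectivity leaves only a
        larger value at the next position.\<close>
      have "\<not> ?u (i + k + 1) < i"
        using u(1)[of "?u (i + k + 1)"] inj by (auto simp: inj_eq)
      moreover have "?u (i + k + 1) \<noteq> i"
        using u(2) inj by (metis Suc_eq_plus1 inj_eq n_not_Suc_n)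
      ultimately have asc: "?u (i + k) < ?u (i + k + 1)"
        using u(2) by simp
      have "finite (rothe ?u)"
        using card_rothe_word_perm_le by blast
      note card = card_rothe_snoc(2)[OF this asc]
      have "word_perm (?v @ [i + k]) y = y" if "y < i" for y
        using that u(1) unfolding word_perm_snoc by simp
      moreover have "word_perm (?v @ [i + k]) (i + Suc k) = i"
        using u(2) unfolding word_perm_snoc by simp
      moreover have "code (word_perm (?v @ [i + k])) = ?c(i := Suc k)"
        unfolding word_perm_snoc code_comp_transpose[OF bij_word_perm asc] by (simp add: u)
      moreover have "card (rothe (word_perm (?v @ [i + k]))) = length ?w + Suc k"
        using card u(4) by simp
      ultimately show ?case
        unfolding w by blast
    qed
    note * = this[of "h i"]
    have "tower_word h (xs @ [i]) = ?w @ [i..<i + h i]"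
      by (simp add: tower_word_def)
    moreover have "?c(i := h i) = (\<lambda>j. if j \<in> set (xs @ [i]) then h j else 0)"
      by auto
    ultimately show ?case
      using * by simp
  qed
  then show "\<And>y. \<forall>x \<in> set xs. y < x \<Longrightarrow> word_perm (tower_word h xs) y = y"
    and "code (word_perm (tower_word h xs)) = (\<lambda>j. if j \<in> set xs then h j else 0)"
    and "card (rothe (word_perm (tower_word h xs))) = length (tower_word h xs)"
    by auto
qed

text \<open>With no cell further left only F1 applies, and the flight path is the cell
  itself.\<close>

lemma flight_number_leftmost:
  assumes "(i, j) \<in> T" and "\<forall>c \<in> T. i \<le> fst c"
  shows "flight_number T (i, j) = i + j"
proof -
  have "flight_path T (i, j) P \<longleftrightarrow> P = {(i, j)}" for P
  proof
    assume "flight_path T (i, j) P"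
    then show "P = {(i, j)}"
      using assms(2) by cases force+
  next
    assume "P = {(i, j)}"
    then show "flight_path T (i, j) P"
      using assms by (auto intro!: flight_path.F1)
  qed
  then show ?thesis
    unfolding flight_number_def by auto
qed

text \<open>Labelling from right to left puts each cell in the leftmost tower of the diagram
  labelled so far.\<close>

lemma reading_word_leftmost:
  assumes "sorted_wrt (\<lambda>c d. fst d \<le> fst c) cs"
  shows "reading_word cs = map (\<lambda>(i, j). i + j) cs"
proof -
  have "flight_number (set (take (k + 1) cs)) (cs ! k) = (\<lambda>(i, j). i + j) (cs ! k)"
    if k: "k < length cs" for k
  proof -
    obtain i j where ij: "cs ! k = (i, j)"
      by fastforce
    have "(i, j) \<in> set (take (k + 1) cs)"
      using k ij by (simp add: take_Suc_conv_app_nth)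
    moreover have "i \<le> fst c" if c: "c \<in> set (take (k + 1) cs)" for c
    proof -
      obtain q where "q \<le> k" "c = cs ! q"
        using c k by (auto simp: in_set_conv_nth less_Suc_eq_le)
      then show ?thesis
        using sorted_wrt_nth_less[OF assms, of q k] k ij by (cases "q = k") auto
    qed
    ultimately show ?thesis
      using flight_number_leftmost ij by auto
  qed
  then show ?thesis
    unfolding reading_word_def by (auto intro!: nth_equalityI)
qed

lemma reading_word_natural_labelling_tower:
  "reading_word (natural_labelling (tower h))
    = tower_word h (rev (sorted_list_of_set {i. 0 < h i}))"
proof -
  define xs where "xs = rev (sorted_list_of_set {i. 0 < h i})"
  have "fst ` tower h = {i. 0 < h i}"
    by (force simp: tower_def)
  moreover have "sorted_list_of_set {j. (i, j) \<in> tower h} = [0..<h i]" for i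
  proof -
    have "{j. (i, j) \<in> tower h} = {0..<h i}"
      by (auto simp: tower_def)
    then show ?thesis
      by simp
  qed
  ultimately have lab: "natural_labelling (tower h) = concat (map (\<lambda>i. map (Pair i) [0..<h i]) xs)"
    by (simp add: natural_labelling_def xs_def)
  have "sorted_wrt (\<ge>) xs"
    by (simp add: xs_def sorted_wrt_rev)
  then have "sorted_wrt (\<lambda>c d. fst d \<le> fst c) (concat (map (\<lambda>i. map (Pair i) [0..<h i]) xs))"
    by (induction xs) (auto simp: sorted_wrt_append sorted_wrt_map)
  moreover have upt_add: "map ((+) i) [0..<k] = [i..<i + k]" for i k
    by (induction k) simp_all
  then have "map (\<lambda>(i, j). i + j) (concat (map (\<lambda>i. map (Pair i) [0..<h i]) xs)) = tower_word h xs"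
    by (simp add: tower_word_def map_concat comp_def upt_add)
  ultimately show ?thesis
    unfolding lab by (simp add: reading_word_leftmost xs_def)
qed

section \<open>Length, tower diagram and natural word of a permutation\<close>

lemma finite_rothe_diagram: "finite (rothe_diagram n \<omega>)"
  by (rule finite_subset[of _ "{..n} \<times> {..n}"]) (auto simp: rothe_diagram_def)

lemma tower_word_code_reduced:
  assumes perm: "\<omega> permutes {1..n}"
  defines "w \<equiv> tower_word (code \<omega>) (rev (sorted_list_of_set {i. 0 < code \<omega> i}))"
  shows "is_word_of \<omega> w" and "length w = card (rothe \<omega>)"
proof -
  let ?A = "{i. 0 < code \<omega> i}"
  \<comment> \<open>Towers of positive height are nonempty columns of the Rothe diagram, so their
    indices are finite in number and positive.\<close>
  have sub: "?A \<subseteq> snd ` rothe \<omega>"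
    by (force simp: code_def card_gt_0_iff)
  then have fin: "finite ?A"
    using finite_rothe_diagram[of n \<omega>] rothe_diagram_eq_rothe[OF perm]
    by (metis finite_imageI finite_subset)
  have pos: "\<forall>i \<in> ?A. 1 \<le> i"
    using sub unfolding rothe_diagram_eq_rothe[OF perm, symmetric]
    by (auto simp: rothe_diagram_def)
  have "sorted_wrt (>) (rev (sorted_list_of_set ?A))"
    by (simp add: sorted_wrt_rev)
  note W = word_perm_tower_word[OF this, where h = "code \<omega>", folded w_def]
  have "code (word_perm w) = code \<omega>"
    using W(3) fin pos by auto
  then have eq: "word_perm w = \<omega>"
    using code_inj bij_word_perm permutes_bij[OF perm] by blast
  then show "is_word_of \<omega> w"
    using W(1) fin pos by (simp add: is_word_of_def)
  show "length w = card (rothe \<omega>)"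
    using W(4) fin pos eq by simp
qed

lemma perm_length_eq_card_rothe:
  assumes "\<omega> permutes {1..n}"
  shows "perm_length \<omega> = card (rothe \<omega>)"
  unfolding perm_length_def
proof (rule Least_equality)
  show "\<exists>w. is_word_of \<omega> w \<and> length w = card (rothe \<omega>)"
    using tower_word_code_reduced[OF assms] by blast
  show "card (rothe \<omega>) \<le> k" if "\<exists>w. is_word_of \<omega> w \<and> length w = k" for k
    using that card_rothe_word_perm_le by (auto simp: is_word_of_def)
qed

text \<open>The definite description is justified by the tower word, which is reduced, and by
  \<open>created_cells_reduced\<close>, whose resulting diagram depends on the permutation
  only.\<close>

lemma tower_diagram_eq_tower_code:
  assumes "\<omega> permutes {1..n}"
  shows "tower_diagram \<omega> = tower (code \<omega>)"
  unfolding tower_diagram_def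
proof (rule the_equality)
  have cells: "\<exists>cs. created_cells {} w = Some cs \<and> set cs = tower (code \<omega>)"
    if "is_reduced_word_of \<omega> w" for w
    using that created_cells_reduced[of w] perm_length_eq_card_rothe[OF assms]
    by (auto simp: is_reduced_word_of_def is_word_of_def)
  show "\<exists>w cs. is_reduced_word_of \<omega> w \<and> created_cells {} w = Some cs \<and> tower (code \<omega>) = set cs"
    using tower_word_code_reduced[OF assms] perm_length_eq_card_rothe[OF assms] cells
    unfolding is_reduced_word_of_def by metis
  show "T = tower (code \<omega>)"
    if "\<exists>w cs. is_reduced_word_of \<omega> w \<and> created_cells {} w = Some cs \<and> T = set cs" for T
    using that cells by force
qed

theorem theorem7p7:
  fixes \<omega> :: "nat \<Rightarrow> nat" and n l :: nat and \<eta> :: "nat list"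
  assumes "\<omega> permutes {1..n}"
    and "perm_length \<omega> = l"
    and "natural_word \<omega> = \<eta>"
  shows "length \<eta> = l \<and>
    (\<exists>cs rs. created_cells {} \<eta> = Some cs \<and> created_cells {} (rev \<eta>) = Some rs \<and>
       rothe_diagram n \<omega> = {(fst (rs ! (l - p)), fst (cs ! (p - 1))) | p. 1 \<le> p \<and> p \<le> l})"
proof -
  have \<eta>: "\<eta> = tower_word (code \<omega>) (rev (sorted_list_of_set {i. 0 < code \<omega> i}))"
    using assms(3) unfolding natural_word_def tower_diagram_eq_tower_code[OF assms(1)]
    by (simp add: reading_word_natural_labelling_tower)
  have len: "length \<eta> = card (rothe \<omega>)" and pos: "\<forall>a \<in> set \<eta>. 1 \<le> a" and eq: "word_perm \<eta> = \<omega>"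
    using tower_word_code_reduced[OF assms(1)] by (auto simp: \<eta> is_word_of_def)
  have l: "length \<eta> = l"
    using len perm_length_eq_card_rothe[OF assms(1)] assms(2) by simp
  have red: "card (rothe (word_perm \<eta>)) = length \<eta>"
    by (simp add: eq len)
  \<comment> \<open>The reversed word represents \<open>inv \<omega>\<close>, whose Rothe diagram is
    the transposed one and has equally many cells.\<close>
  have red_rev: "card (rothe (word_perm (rev \<eta>))) = length (rev \<eta>)"
    using red by (simp add: word_perm_rev rothe_inv bij_word_perm card_image)
  obtain cs where cs: "created_cells {} \<eta> = Some cs"
    "map fst cs = map (\<lambda>p. word_perm (take p \<eta>) (\<eta> ! p)) [0..<length \<eta>]"
    using created_cells_reduced[OF red pos] by blast
  obtain rs where rs: "created_cells {} (rev \<eta>) = Some rs"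
    "map fst rs = map (\<lambda>p. word_perm (take p (rev \<eta>)) (rev \<eta> ! p)) [0..<length (rev \<eta>)]"
    using created_cells_reduced[OF red_rev] pos by auto
  have c: "fst (cs ! q) = word_perm (take q \<eta>) (\<eta> ! q)" if "q < l" for q
    using arg_cong[OF cs(2), of "\<lambda>xs. xs ! q"] arg_cong[OF cs(2), of length] that l by simp
  \<comment> \<open>Letter \<open>q\<close> of \<open>\<eta>\<close> is letter
    \<open>l - Suc q\<close> of \<open>rev \<eta>\<close>, and the letters slid before it there are
    those after \<open>q\<close> in \<open>\<eta>\<close>, reversed.\<close>
  have r: "fst (rs ! (l - Suc q)) = word_perm (rev (drop (Suc q) \<eta>)) (\<eta> ! q)" if "q < l" for q
    using arg_cong[OF rs(2), of "\<lambda>xs. xs ! (l - Suc q)"] arg_cong[OF rs(2), of length] that l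
    by (simp add: rev_nth take_rev Suc_diff_Suc)
  have "rothe_diagram n \<omega> = (\<lambda>q. (fst (rs ! (l - Suc q)), fst (cs ! q))) ` {..<l}"
    using rothe_word_perm_reduced[OF red] c r
    by (simp add: rothe_diagram_eq_rothe[OF assms(1)] eq l)
  \<comment> \<open>Here \<open>p = Suc q\<close>, since lists count from 0 and steps from
    1.\<close>
  also have "\<dots> = {(fst (rs ! (l - p)), fst (cs ! (p - 1))) | p. 1 \<le> p \<and> p \<le> l}"
    by (force simp: image_iff Suc_le_eq gr0_conv_Suc)
  finally show ?thesis
    using cs(1) rs(1) l by blast
qed

end
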